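(* Let $T$ be a string of length $n$ over a totally ordered alphabet $\Sigma$. There is an algorithm that computes a longest subsequence $S$ of $T$ having at least one exponent in $\mathbb{Q}^+ \setminus \mathbb{N}$ (i.e., a longest subsequence $S$ of $T$ for which there exists a period $p$ of $S$ whose associated exponent $|S|/p$ is a rational number strictly greater than $1$ that is not an integer). The algorithm runs in $O(n^3)$ time and uses $O(n^2)$ words of space.
   Context: $\mathbb{N}=\{1,2,\dots\}$ and $\mathbb{Q}^+$ denotes the set of rational numbers greater than or equal to $1$. A subsequence of a string $T$ is a string $T[i_1]T[i_2]\cdots T[i_\ell]$ with $i_1<\dots<i_\ell$. For a string $S$, write $S = U^x U'$ where $x\in\mathbb{N}$, $U$ is nonempty and $U'$ is empty or a proper prefix of $U$; then $|U|$ is called a period of $S$ and $x + |U'|/|U| \in \mathbb{Q}^+$ (which equals $|S|/|U|$) is called the exponent of $S$ with respect to the period $|U|$. A string may have several periods and hence several exponents; "having an exponent in a set $E$" means that at least one of its exponents lies in $E$. *)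

theory Defs
  imports Complex_Main "HOL-Library.Sublist" "HOL-Library.Landau_Symbols"
begin

definition exponent_wrt :: "'a list \<Rightarrow> nat \<Rightarrow> rat \<Rightarrow> bool" where
  "exponent_wrt S p e \<longleftrightarrow>
     (\<exists>U U' x. S = concat (replicate x U) @ U' \<and> 1 \<le> x \<and> U \<noteq> [] \<and>
        (U' = [] \<or> strict_prefix U' U) \<and>
        p = length U \<and> e = of_nat x + of_nat (length U') / of_nat (length U))"

definition has_exponent_in :: "'a list \<Rightarrow> rat set \<Rightarrow> bool" where
  "has_exponent_in S E \<longleftrightarrow> (\<exists>p. \<exists>e\<in>E. exponent_wrt S p e)"

definition longest_subseq_with_exponent_in :: "rat set \<Rightarrow> 'a list \<Rightarrow> 'a list \<Rightarrow> bool" where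
  "longest_subseq_with_exponent_in E T S \<longleftrightarrow>
     subseq S T \<and> has_exponent_in S E \<and>
     (\<forall>S'. subseq S' T \<and> has_exponent_in S' E \<longrightarrow> length S' \<le> length S)"

definition Nat_pos :: "rat set" where
  "Nat_pos = of_nat ` {1..}"

definition Rat_ge1 :: "rat set" where
  "Rat_ge1 = {1..}"

text \<open>
  The machine model is a unit-cost word RAM with structured control flow. Words are natural
  numbers below \<open>2 ^ w\<close>. The input string is read-only: its symbols cannot be turned into
  words, only compared with each other in constant time (general ordered alphabet) or
  appended to a write-only output string. A program mentions finitely many registers, so these
  contribute a constant to its space; the rest of its working space is the length of the
  word-addressed memory. Accessing an input position or a memory cell that does not exist
  leaves the machine without a successor state.
\<close>

type_synonym reg = nat

datatype arith = Add | Sub | Mul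

datatype test =
    WordLess reg reg
  | WordEq reg reg
  | SymLess reg reg
  | SymEq reg reg

datatype com =
    Skip
  | Const reg nat
  | Move reg reg
  | Arith arith reg reg reg
  | Load reg reg
  | Store reg reg
  | Emit reg
  | Seq com com
  | Cond test com com
  | While test com

record 'a state =
  regs :: "reg \<Rightarrow> nat"
  memory :: "nat list"
  emitted :: "'a list"

fun arith_val :: "nat \<Rightarrow> arith \<Rightarrow> nat \<Rightarrow> nat \<Rightarrow> nat" where
  "arith_val w Add a b = (a + b) mod 2 ^ w"
| "arith_val w Sub a b = (a + 2 ^ w - b) mod 2 ^ w"
| "arith_val w Mul a b = (a * b) mod 2 ^ w"

fun test_val :: "'a::linorder list \<Rightarrow> 'a state \<Rightarrow> test \<Rightarrow> bool option" where
  "test_val T s (WordLess x y) = Some (regs s x < regs s y)"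
| "test_val T s (WordEq x y) = Some (regs s x = regs s y)"
| "test_val T s (SymLess x y) =
     (if regs s x < length T \<and> regs s y < length T
      then Some (T ! regs s x < T ! regs s y) else None)"
| "test_val T s (SymEq x y) =
     (if regs s x < length T \<and> regs s y < length T
      then Some (T ! regs s x = T ! regs s y) else None)"

text \<open>
  \<open>exec w T c s t s'\<close>: with word length \<open>w\<close> and input string \<open>T\<close>, the program \<open>c\<close> started in
  state \<open>s\<close> halts in state \<open>s'\<close> after exactly \<open>t\<close> elementary steps; every instruction and every
  evaluation of a test is one step.
\<close>

inductive exec :: "nat \<Rightarrow> 'a::linorder list \<Rightarrow> com \<Rightarrow> 'a state \<Rightarrow> nat \<Rightarrow> 'a state \<Rightarrow> bool"
  for w :: nat and T :: "'a list" where
  Skip: "exec w T Skip s 1 s"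
| Const: "exec w T (Const x k) s 1 (s\<lparr>regs := (regs s)(x := k mod 2 ^ w)\<rparr>)"
| Move: "exec w T (Move x y) s 1 (s\<lparr>regs := (regs s)(x := regs s y)\<rparr>)"
| Arith: "exec w T (Arith f x y z) s 1
     (s\<lparr>regs := (regs s)(x := arith_val w f (regs s y) (regs s z))\<rparr>)"
| Load: "regs s y < length (memory s) \<Longrightarrow>
     exec w T (Load x y) s 1 (s\<lparr>regs := (regs s)(x := memory s ! regs s y)\<rparr>)"
| Store: "regs s x < length (memory s) \<Longrightarrow>
     exec w T (Store x y) s 1 (s\<lparr>memory := (memory s)[regs s x := regs s y]\<rparr>)"
| Emit: "regs s x < length T \<Longrightarrow>
     exec w T (Emit x) s 1 (s\<lparr>emitted := emitted s @ [T ! regs s x]\<rparr>)"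
| Seq: "exec w T c s t s' \<Longrightarrow> exec w T d s' t' s'' \<Longrightarrow> exec w T (Seq c d) s (t + t') s''"
| CondTrue: "test_val T s b = Some True \<Longrightarrow> exec w T c s t s' \<Longrightarrow>
     exec w T (Cond b c d) s (Suc t) s'"
| CondFalse: "test_val T s b = Some False \<Longrightarrow> exec w T d s t s' \<Longrightarrow>
     exec w T (Cond b c d) s (Suc t) s'"
| WhileFalse: "test_val T s b = Some False \<Longrightarrow> exec w T (While b c) s 1 s"
| WhileTrue: "test_val T s b = Some True \<Longrightarrow> exec w T c s t s' \<Longrightarrow>
     exec w T (While b c) s' t' s'' \<Longrightarrow> exec w T (While b c) s (Suc (t + t')) s''"

inductive_cases exec_SkipE: "exec w T Skip s t s'"
inductive_cases exec_ConstE: "exec w T (Const x k) s t s'"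
inductive_cases exec_MoveE: "exec w T (Move x y) s t s'"
inductive_cases exec_ArithE: "exec w T (Arith f x y z) s t s'"
inductive_cases exec_LoadE: "exec w T (Load x y) s t s'"
inductive_cases exec_StoreE: "exec w T (Store x y) s t s'"
inductive_cases exec_EmitE: "exec w T (Emit x) s t s'"
inductive_cases exec_SeqE: "exec w T (Seq c d) s t s'"
inductive_cases exec_CondE: "exec w T (Cond b c d) s t s'"
inductive_cases exec_WhileE: "exec w T (While b c) s t s'"

lemma exec_deterministic:
  "exec w T c s t s' \<Longrightarrow> exec w T c s u s'' \<Longrightarrow> u = t \<and> s'' = s'"
proof (induction arbitrary: u s'' rule: exec.induct)
  case (Skip s)
  then show ?case by (elim exec_SkipE) simp
next
  case (Const x k s)
  then show ?case by (elim exec_ConstE) simp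
next
  case (Move x y s)
  then show ?case by (elim exec_MoveE) simp
next
  case (Arith f x y z s)
  then show ?case by (elim exec_ArithE) simp
next
  case (Load s y x)
  from Load.prems show ?case by (elim exec_LoadE) simp
next
  case (Store s x y)
  from Store.prems show ?case by (elim exec_StoreE) simp
next
  case (Emit s x)
  from Emit.prems show ?case by (elim exec_EmitE) simp
next
  case (Seq c s t s' d t' s1)
  from Seq.prems obtain t1 t2 r where r: "exec w T c s t1 r" "exec w T d r t2 s''" "u = t1 + t2"
    by (elim exec_SeqE)
  from Seq.IH(1)[OF r(1)] have "t1 = t" "r = s'" by blast+
  with Seq.IH(2)[of t2 s''] r show ?case by blast
next
  case (CondTrue s b c t s' d)
  from CondTrue.prems CondTrue.hyps(1) obtain t1 where "exec w T c s t1 s''" "u = Suc t1"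
    by (elim exec_CondE) auto
  with CondTrue.IH[of t1 s''] show ?case by blast
next
  case (CondFalse s b d t s' c)
  from CondFalse.prems CondFalse.hyps(1) obtain t1 where "exec w T d s t1 s''" "u = Suc t1"
    by (elim exec_CondE) auto
  with CondFalse.IH[of t1 s''] show ?case by blast
next
  case (WhileFalse s b c)
  from WhileFalse.prems show ?case
  proof (rule exec_WhileE)
    assume "u = Suc 0" "s'' = s"
    then show ?case by simp
  qed (use WhileFalse.hyps in auto)
next
  case (WhileTrue s b c t s' t' s1)
  from WhileTrue.prems obtain t1 t2 r where
    r: "exec w T c s t1 r" "exec w T (While b c) r t2 s''" "u = Suc (t1 + t2)"
  proof (rule exec_WhileE)
    assume "test_val T s b = Some False"
    with WhileTrue.hyps(1) show thesis by simp
  qed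
  from WhileTrue.IH(1)[OF r(1)] have "t1 = t" "r = s'" by blast+
  with WhileTrue.IH(2)[of t2 s''] r show ?case by blast
qed

text \<open>Initially register 0 holds the length of the input; all else is zero.\<close>

definition initial_state :: "nat \<Rightarrow> nat \<Rightarrow> 'a state" where
  "initial_state n m =
     \<lparr>regs = (\<lambda>_. 0)(0 := n), memory = replicate m 0, emitted = []\<rparr>"

text \<open>
  \<open>solves_within c time space R\<close>: on every input \<open>T\<close> the program \<open>c\<close> halts within \<open>time (length T)\<close>
  steps, using at most \<open>space (length T)\<close> words of memory, with an output related to \<open>T\<close> by \<open>R\<close>.
  The word length is arbitrary, subject only to the usual assumption that the input length
  and all memory addresses fit into one word; hence \<open>w\<close> may be as small as logarithmic in the
  length of \<open>T\<close> when \<open>space\<close> is polynomially bounded.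
\<close>

definition solves_within ::
  "com \<Rightarrow> (nat \<Rightarrow> nat) \<Rightarrow> (nat \<Rightarrow> nat) \<Rightarrow> ('a::linorder list \<Rightarrow> 'a list \<Rightarrow> bool) \<Rightarrow> bool" where
  "solves_within c time space R \<longleftrightarrow>
     (\<forall>T w. length T < 2 ^ w \<and> space (length T) \<le> 2 ^ w \<longrightarrow>
        (\<exists>t s. exec w T c (initial_state (length T) (space (length T))) t s \<and>
               t \<le> time (length T) \<and> R T (emitted s)))"

end

theory Submission imports Defs begin

text \<open>
  If \<open>p\<close> is a period of \<open>S\<close> with non-integer exponent \<open>x + r\<close>, \<open>0 < r < 1\<close>, then \<open>x p\<close> is a
  period with exponent strictly between 1 and 2. So the strings in question are exactly those of
  the form \<open>W V W\<close> with \<open>W\<close> and \<open>V\<close> nonempty. A longest such subsequence of \<open>T\<close> is found by trying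
  all splits of \<open>T\<close> at positions \<open>i < j\<close>: take \<open>V = T[i..j)\<close> and for \<open>W\<close> a longest common
  subsequence of \<open>T[0..i)\<close> and \<open>T[j..n)\<close>. For fixed \<open>i\<close>, a single quadratic table of the LCS
  lengths of \<open>T[a..i)\<close> and \<open>T[b..n)\<close> serves all \<open>j\<close> (row \<open>a = 0\<close>), which gives cubic time in
  total. Indexing the table by suffixes lets the traceback emit \<open>W\<close> from left to right; the table
  for the optimal \<open>i\<close> is recomputed at the end.
\<close>

lemma noninteger_exponent_iff:
  "has_exponent_in S (Rat_ge1 - Nat_pos) \<longleftrightarrow> (\<exists>W V. S = W @ V @ W \<and> W \<noteq> [] \<and> V \<noteq> [])"
proof
  assume "has_exponent_in S (Rat_ge1 - Nat_pos)"
  then obtain U U' x where S: "S = concat (replicate x U) @ U'" and x: "1 \<le> x"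
    and U': "U' = [] \<or> strict_prefix U' U"
    and e: "(of_nat x + of_nat (length U') / of_nat (length U) :: rat) \<notin> Nat_pos"
    unfolding has_exponent_in_def exponent_wrt_def by blast
  have "U' \<noteq> []"
    using e x by (auto simp: Nat_pos_def)
  with U' obtain V where V: "U = U' @ V" "V \<noteq> []"
    by (metis append_Nil2 strict_prefix_def prefixE)
  obtain y where "x = Suc y"
    using x by (cases x) auto
  with S V have "S = U' @ (V @ concat (replicate y U)) @ U'"
    by simp
  with \<open>U' \<noteq> []\<close> \<open>V \<noteq> []\<close> show "\<exists>W V. S = W @ V @ W \<and> W \<noteq> [] \<and> V \<noteq> []"
    by blast
next
  assume "\<exists>W V. S = W @ V @ W \<and> W \<noteq> [] \<and> V \<noteq> []"
  then obtain W V where S: "S = W @ V @ W" and "W \<noteq> []" "V \<noteq> []"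
    by blast
  define e :: rat where "e = of_nat 1 + of_nat (length W) / of_nat (length (W @ V))"
  have "exponent_wrt S (length (W @ V)) e"
    unfolding exponent_wrt_def e_def
    by (rule exI[of _ "W @ V"], rule exI[of _ W], rule exI[of _ 1])
      (use S \<open>W \<noteq> []\<close> \<open>V \<noteq> []\<close> in \<open>auto simp: strict_prefix_def\<close>)
  moreover have bounds: "1 < e" "e < 2"
  proof -
    have "0 < (of_nat (length W) :: rat)" "0 < (of_nat (length V) :: rat)"
      using \<open>W \<noteq> []\<close> \<open>V \<noteq> []\<close> by simp_all
    moreover from this have "0 < (of_nat (length W) + of_nat (length V) :: rat)"
      by (rule add_pos_pos)
    ultimately show "1 < e" "e < 2"
      by (simp_all add: e_def divide_simps)
  qed
  moreover have "e \<notin> Nat_pos"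
  proof
    assume "e \<in> Nat_pos"
    then obtain k :: nat where "e = of_nat k"
      by (auto simp: Nat_pos_def)
    with bounds have "of_nat 1 < (of_nat k :: rat)" "(of_nat k :: rat) < of_nat 2"
      by simp_all
    then show False
      unfolding of_nat_less_iff by simp
  qed
  ultimately show "has_exponent_in S (Rat_ge1 - Nat_pos)"
    unfolding has_exponent_in_def Rat_ge1_def by fastforce
qed

fun lcs :: "'a list \<Rightarrow> 'a list \<Rightarrow> 'a list" where
  "lcs (x # xs) (y # ys) =
     (if x = y then x # lcs xs ys
      else if length (lcs xs (y # ys)) < length (lcs (x # xs) ys) then lcs (x # xs) ys
      else lcs xs (y # ys))"
| "lcs _ _ = []"

lemma lcs_Nil [simp]: "lcs [] ys = []" "lcs xs [] = []"
  by (cases xs; simp)+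

lemma subseq_lcs1: "subseq (lcs xs ys) xs"
  by (induction xs ys rule: lcs.induct) auto

lemma subseq_lcs2: "subseq (lcs xs ys) ys"
  by (induction xs ys rule: lcs.induct) auto

lemma length_lcs_maximal: "subseq zs xs \<Longrightarrow> subseq zs ys \<Longrightarrow> length zs \<le> length (lcs xs ys)"
proof (induction xs ys arbitrary: zs rule: lcs.induct)
  case (1 x xs y ys)
  show ?case
  proof (cases zs)
    case Nil
    then show ?thesis by simp
  next
    case (Cons z zs')
    show ?thesis
    proof (cases "x = y")
      case True
      have "subseq zs' xs" "subseq zs' ys"
        using "1.prems" by (auto simp: Cons split: if_splits dest: subseq_Cons')
      with "1.IH"(1) True show ?thesis by (simp add: Cons)
    next
      case False
      then have "subseq zs xs \<or> subseq zs ys"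
        using "1.prems" by (auto simp: Cons split: if_splits)
      then have "length zs \<le> length (lcs xs (y # ys)) \<or> length zs \<le> length (lcs (x # xs) ys)"
        using "1.IH"(2,3)[OF False, of zs] "1.prems" by blast
      with False show ?thesis by auto
    qed
  qed
qed auto

text \<open>
  Weakest precondition with a clock: \<open>e\<close> is the number of steps elapsed before \<open>c\<close> starts, and
  the postcondition receives the number elapsed when it halts.
\<close>

definition wp ::
  "nat \<Rightarrow> 'a::linorder list \<Rightarrow> com \<Rightarrow> ('a state \<Rightarrow> nat \<Rightarrow> bool) \<Rightarrow> 'a state \<Rightarrow> nat \<Rightarrow> bool" where
  "wp w T c Q s e \<longleftrightarrow> (\<exists>t s'. exec w T c s t s' \<and> Q s' (e + t))"

lemma wp_mono: "wp w T c Q s e \<Longrightarrow> (\<And>s' e'. Q s' e' \<Longrightarrow> Q' s' e') \<Longrightarrow> wp w T c Q' s e"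
  unfolding wp_def by blast

lemma wp_iff: "exec w T c s t s' \<Longrightarrow> wp w T c Q s e \<longleftrightarrow> Q s' (e + t)"
  unfolding wp_def using exec_deterministic by blast

lemma wp_Skip [simp]: "wp w T Skip Q s e \<longleftrightarrow> Q s (Suc e)"
  by (simp add: wp_iff[OF exec.Skip])

lemma wp_Const [simp]:
  "wp w T (Const x k) Q s e \<longleftrightarrow> Q (s\<lparr>regs := (regs s)(x := k mod 2 ^ w)\<rparr>) (Suc e)"
  by (simp add: wp_iff[OF exec.Const])

lemma wp_Move [simp]:
  "wp w T (Move x y) Q s e \<longleftrightarrow> Q (s\<lparr>regs := (regs s)(x := regs s y)\<rparr>) (Suc e)"
  by (simp add: wp_iff[OF exec.Move])

lemma wp_Arith [simp]:
  "wp w T (Arith f x y z) Q s e \<longleftrightarrow>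
     Q (s\<lparr>regs := (regs s)(x := arith_val w f (regs s y) (regs s z))\<rparr>) (Suc e)"
  by (simp add: wp_iff[OF exec.Arith])

lemma wp_Load [simp]:
  "wp w T (Load x y) Q s e \<longleftrightarrow> regs s y < length (memory s) \<and>
     Q (s\<lparr>regs := (regs s)(x := memory s ! regs s y)\<rparr>) (Suc e)"
proof (cases "regs s y < length (memory s)")
  case True
  then show ?thesis by (simp add: wp_iff[OF exec.Load])
qed (auto simp: wp_def elim: exec_LoadE)

lemma wp_Store [simp]:
  "wp w T (Store x y) Q s e \<longleftrightarrow> regs s x < length (memory s) \<and>
     Q (s\<lparr>memory := (memory s)[regs s x := regs s y]\<rparr>) (Suc e)"
proof (cases "regs s x < length (memory s)")
  case True
  then show ?thesis by (simp add: wp_iff[OF exec.Store])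
qed (auto simp: wp_def elim: exec_StoreE)

lemma wp_Emit [simp]:
  "wp w T (Emit x) Q s e \<longleftrightarrow> regs s x < length T \<and>
     Q (s\<lparr>emitted := emitted s @ [T ! regs s x]\<rparr>) (Suc e)"
proof (cases "regs s x < length T")
  case True
  then show ?thesis by (simp add: wp_iff[OF exec.Emit])
qed (auto simp: wp_def elim: exec_EmitE)

lemma wp_Seq [simp]: "wp w T (Seq c d) Q s e \<longleftrightarrow> wp w T c (wp w T d Q) s e"
proof
  assume "wp w T (Seq c d) Q s e"
  then obtain t s'' where "exec w T (Seq c d) s t s''" "Q s'' (e + t)"
    unfolding wp_def by blast
  then show "wp w T c (wp w T d Q) s e"
    unfolding wp_def by (metis exec_SeqE add.assoc)
next
  assume "wp w T c (wp w T d Q) s e"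
  then show "wp w T (Seq c d) Q s e"
    unfolding wp_def by (metis exec.Seq add.assoc)
qed

lemma wp_Cond [simp]:
  "wp w T (Cond b c d) Q s e \<longleftrightarrow>
     (case test_val T s b of None \<Rightarrow> False
      | Some v \<Rightarrow> if v then wp w T c Q s (Suc e) else wp w T d Q s (Suc e))"
proof (cases "test_val T s b")
  case None
  then show ?thesis by (auto simp: wp_def elim: exec_CondE)
next
  case (Some v)
  have "exec w T (Cond b c d) s t s' \<longleftrightarrow>
      (\<exists>t'. t = Suc t' \<and> exec w T (if v then c else d) s t' s')" for t s'
    using Some exec.CondTrue[of T s b w c _ s' d] exec.CondFalse[of T s b w d _ s' c]
    by (cases v) (auto elim!: exec_CondE)
  then have "wp w T (Cond b c d) Q s e \<longleftrightarrow> wp w T (if v then c else d) Q s (Suc e)"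
    unfolding wp_def by (metis add_Suc add_Suc_right)
  with Some show ?thesis by simp
qed

lemma wp_While_less:
  fixes m :: "'a::linorder state \<Rightarrow> nat"
  assumes "I s e"
    and step: "\<And>s e. I s e \<Longrightarrow> regs s x < regs s y \<Longrightarrow>
      wp w T c (\<lambda>s' e'. I s' e' \<and> m s' < m s) s (Suc e)"
    and exit: "\<And>s e. I s e \<Longrightarrow> \<not> regs s x < regs s y \<Longrightarrow> Q s (Suc e)"
  shows "wp w T (While (WordLess x y) c) Q s e"
  using assms(1)
proof (induction "m s" arbitrary: s e rule: less_induct)
  case less
  show ?case
  proof (cases "regs s x < regs s y")
    case True
    obtain t s' where c: "exec w T c s t s'" "I s' (Suc e + t)" "m s' < m s"
      using step[OF less.prems True] unfolding wp_def by blast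
    from less.hyps[OF c(3,2)] obtain t' s'' where
      "exec w T (While (WordLess x y) c) s' t' s''" "Q s'' (Suc e + t + t')"
      unfolding wp_def by blast
    with True c(1) exec.WhileTrue[of T s "WordLess x y" w c t s' t' s''] show ?thesis
      unfolding wp_def by (intro exI[of _ "Suc (t + t')"] exI[of _ s'']) (simp add: add.assoc)
  next
    case False
    with exit[OF less.prems] exec.WhileFalse[of T s "WordLess x y" w c] show ?thesis
      unfolding wp_def by (intro exI[of _ 1] exI[of _ s]) simp
  qed
qed

fun block :: "com list \<Rightarrow> com" where
  "block [] = Skip"
| "block (c # cs) = Seq c (block cs)"

declare arith_val.simps [simp del]

lemma arith_val_Add [simp]: "a + b < 2 ^ w \<Longrightarrow> arith_val w Add a b = a + b"
  by (simp add: arith_val.simps)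

lemma arith_val_Mul [simp]: "a * b < 2 ^ w \<Longrightarrow> arith_val w Mul a b = a * b"
  by (simp add: arith_val.simps)

lemma arith_val_Sub [simp]:
  assumes "b \<le> a" "a < 2 ^ w"
  shows "arith_val w Sub a b = a - b"
proof -
  have "a + 2 ^ w - b = (a - b) + 2 ^ w"
    using assms by simp
  then show ?thesis
    using assms by (simp only: arith_val.simps mod_add_self2) simp
qed

text \<open>
  Registers: 0 holds \<open>n\<close>, 2 the constant 1, 3 the constant 0, 4 the row length \<open>n + 1\<close> of the
  table; 5 is the split position \<open>i\<close>, 6 and 7 are the table indices \<open>a\<close> and \<open>b\<close>, 8 is a table
  entry or candidate length, 9 to 11 are scratch, 12 is the split position \<open>j\<close>, and 13 to 15 hold
  the best length so far (0 if none) with its \<open>i\<close> and \<open>j\<close>.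
\<close>

definition cell_prog :: com where
  "cell_prog = block
    [Arith Mul 9 6 4, Arith Add 9 9 7, Move 8 3,
     Cond (WordLess 6 5)
       (Cond (WordLess 7 0)
         (Cond (SymEq 6 7)
           (block [Arith Add 10 9 4, Arith Add 10 10 2, Load 8 10, Arith Add 8 8 2])
           (block [Arith Add 10 9 4, Load 10 10, Arith Add 11 9 2, Load 11 11,
              Cond (WordLess 10 11) (Move 8 11) (Move 8 10)]))
         Skip)
       Skip,
     Store 9 8]"

definition row_prog :: com where
  "row_prog = Seq (Move 7 4) (While (WordLess 3 7) (Seq (Arith Sub 7 7 2) cell_prog))"

definition fill_prog :: com where
  "fill_prog = Seq (Arith Add 6 5 2) (While (WordLess 3 6) (Seq (Arith Sub 6 6 2) row_prog))"

definition scan_prog :: com where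
  "scan_prog = Seq (Move 12 0) (While (WordLess 3 12) (Seq (Arith Sub 12 12 2)
     (Cond (WordLess 5 12)
       (Seq (Load 8 12)
         (Cond (WordLess 3 8)
           (block [Arith Add 8 8 8, Arith Add 8 8 12, Arith Sub 8 8 5,
              Cond (WordLess 13 8) (block [Move 13 8, Move 14 5, Move 15 12]) Skip])
           Skip))
       Skip)))"

definition search_prog :: com where
  "search_prog = Seq (Move 5 0) (While (WordLess 3 5)
     (Seq (Arith Sub 5 5 2) (Seq fill_prog scan_prog)))"

definition trace_prog :: com where
  "trace_prog = Seq (Move 6 3) (Seq (Move 7 15) (Seq (Load 8 7)
     (While (WordLess 3 8) (block
       [Arith Mul 9 6 4, Arith Add 9 9 7,
        Cond (SymEq 6 7)
          (block [Emit 6, Arith Add 6 6 2, Arith Add 7 7 2])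
          (block [Arith Add 10 9 4, Load 10 10,
             Cond (WordEq 10 8) (Arith Add 6 6 2) (Arith Add 7 7 2)]),
        Arith Mul 9 6 4, Arith Add 9 9 7, Load 8 9]))))"

definition middle_prog :: com where
  "middle_prog = Seq (Move 6 14) (While (WordLess 6 15) (Seq (Emit 6) (Arith Add 6 6 2)))"

definition main_prog :: com where
  "main_prog = Seq (Const 2 1) (Seq (Arith Add 4 0 2) (Seq search_prog
     (Cond (WordLess 3 13)
       (block [Move 5 14, fill_prog, trace_prog, middle_prog, trace_prog]) Skip)))"

definition same_but :: "reg set \<Rightarrow> 'a state \<Rightarrow> 'a state \<Rightarrow> bool" where
  "same_but X s s' \<longleftrightarrow> (\<forall>r. r \<notin> X \<longrightarrow> regs s' r = regs s r) \<and>
     length (memory s') = length (memory s)"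

locale word_ram =
  fixes w :: nat and T :: "'a::linorder list" and n N :: nat
  assumes n_def: "n = length T" and N_def: "N = Suc n" and words: "(n + 2)\<^sup>2 \<le> 2 ^ w"
begin

lemma small_word: "x \<le> 3 * n + 3 \<Longrightarrow> x < 2 ^ w"
  using words by (simp add: power2_eq_square)

lemma addr_bound: "a \<le> n \<Longrightarrow> b \<le> N \<Longrightarrow> a * N + b < (n + 2)\<^sup>2"
proof -
  assume "a \<le> n" "b \<le> N"
  then have "a * N + b \<le> n * N + N"
    by (intro add_mono mult_mono) auto
  also have "\<dots> < (n + 2)\<^sup>2"
    by (simp add: N_def power2_eq_square)
  finally show ?thesis .
qed

lemma addr_inj: "b \<le> n \<Longrightarrow> b' \<le> n \<Longrightarrow> a * N + b = a' * N + b' \<longleftrightarrow> a = a' \<and> b = b'"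
proof (intro iffI; (elim conjE)?)
  assume le: "b \<le> n" "b' \<le> n" and eq: "a * N + b = a' * N + b'"
  then have "(a * N + b) div N = (a' * N + b') div N" by simp
  moreover have "b < N" "b' < N" "N \<noteq> 0"
    using le by (simp_all add: N_def)
  ultimately have "a = a'" by simp
  with eq show "a = a' \<and> b = b'" by simp
qed auto

abbreviation sol :: "nat \<Rightarrow> nat \<Rightarrow> nat \<Rightarrow> 'a list" where
  "sol i a b \<equiv> lcs (drop a (take i T)) (drop b T)"

lemma sol_stop: "i \<le> a \<or> n \<le> b \<Longrightarrow> sol i a b = []"
  by (auto simp: n_def)

lemma sol_step:
  assumes "a < i" "i \<le> n" "b < n"
  shows "sol i a b =
    (if T ! a = T ! b then T ! a # sol i (Suc a) (Suc b)
     else if length (sol i (Suc a) b) < length (sol i a (Suc b)) then sol i a (Suc b)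
     else sol i (Suc a) b)"
proof -
  have "drop a (take i T) = T ! a # drop (Suc a) (take i T)"
    using assms by (simp add: n_def flip: Cons_nth_drop_Suc)
  moreover have "drop b T = T ! b # drop (Suc b) T"
    using assms by (simp add: n_def Cons_nth_drop_Suc)
  ultimately show ?thesis by simp
qed

lemma length_sol_le: "length (sol i a b) \<le> n"
  using list_emb_length[OF subseq_lcs2[of "drop a (take i T)" "drop b T"]] by (simp add: n_def)

definition ready :: "'a state \<Rightarrow> bool" where
  "ready s \<longleftrightarrow> regs s 0 = n \<and> regs s 2 = 1 \<and> regs s 3 = 0 \<and> regs s 4 = N \<and>
     length (memory s) = (n + 2)\<^sup>2"

text \<open>
  The table is filled by decreasing \<open>a\<close>, then decreasing \<open>b\<close>; \<open>filled i a b s\<close> says that all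
  entries up to and including \<open>(a, b)\<close> in this order are correct.
\<close>

definition filled :: "nat \<Rightarrow> nat \<Rightarrow> nat \<Rightarrow> 'a state \<Rightarrow> bool" where
  "filled i a b s \<longleftrightarrow> (\<forall>a' b'. a' \<le> i \<longrightarrow> b' \<le> n \<longrightarrow> a < a' \<or> a = a' \<and> b \<le> b' \<longrightarrow>
     memory s ! (a' * N + b') = length (sol i a' b'))"

lemma filledD:
  "filled i a b s \<Longrightarrow> a' \<le> i \<Longrightarrow> b' \<le> n \<Longrightarrow> a < a' \<or> a = a' \<and> b \<le> b' \<Longrightarrow>
     memory s ! (a' * N + b') = length (sol i a' b')"
  unfolding filled_def by blast

lemma filled_store:
  assumes "filled i a (Suc b) s" "a \<le> i" "i \<le> n" "b \<le> n" "length (memory s) = (n + 2)\<^sup>2"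
    "memory s' = (memory s)[a * N + b := length (sol i a b)]"
  shows "filled i a b s'"
  unfolding filled_def
proof (intro allI impI)
  fix a' b' assume *: "a' \<le> i" "b' \<le> n" "a < a' \<or> a = a' \<and> b \<le> b'"
  show "memory s' ! (a' * N + b') = length (sol i a' b')"
  proof (cases "a' = a \<and> b' = b")
    case True
    then show ?thesis
      using assms addr_bound[of a b] by (simp add: N_def)
  next
    case False
    then have "a' * N + b' \<noteq> a * N + b" "a < a' \<or> a = a' \<and> Suc b \<le> b'"
      using * assms(4) by (auto simp: addr_inj)
    with filledD[OF assms(1) *(1,2)] assms(6) show ?thesis by simp
  qed
qed

lemma wp_cell:
  assumes s: "ready s" "regs s 5 = i" "regs s 6 = a" "regs s 7 = b"
    and le: "i \<le> n" "a \<le> i" "b \<le> n" and f: "filled i a (Suc b) s"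
  shows "wp w T cell_prog (\<lambda>s' e'. same_but {8..11} s s' \<and> emitted s' = emitted s \<and>
    filled i a b s' \<and> e' \<le> e + 16) s e"
proof -
  note r = s(1)[unfolded ready_def] s(2-4)
  have addr: "a * N + b < (n + 2)\<^sup>2"
    using addr_bound[of a b] le by (simp add: N_def)
  have aN: "a * N < 2 ^ w" and word: "a * N + b < 2 ^ w"
    using addr words by linarith+
  show ?thesis
  proof (cases "a < i \<and> b < n")
    case False
    then have "sol i a b = []"
      by (intro sol_stop) auto
    then have "filled i a b (s\<lparr>regs := R, memory := (memory s)[a * N + b := 0]\<rparr>)" for R
      using filled_store[OF f le(2,1,3)] r by simp
    with False r le addr aN word show ?thesis
      by (auto simp: cell_prog_def same_but_def)
  next
    case True
    then have "a < i" "b < n" by auto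
    have addr': "a * N + b + N < (n + 2)\<^sup>2" "a * N + b + N + 1 < (n + 2)\<^sup>2"
        "a * N + b + 1 < (n + 2)\<^sup>2"
      using addr_bound[of "Suc a" b] addr_bound[of "Suc a" "Suc b"] addr_bound[of a "Suc b"]
        le \<open>a < i\<close> \<open>b < n\<close> by (simp_all add: N_def)
    have word': "a * N + b + N < 2 ^ w" "a * N + b + N + 1 < 2 ^ w" "a * N + b + 1 < 2 ^ w"
      using addr' words by linarith+
    have mem: "memory s ! (a * N + b + N) = length (sol i (Suc a) b)"
        "memory s ! (a * N + b + N + 1) = length (sol i (Suc a) (Suc b))"
        "memory s ! (a * N + b + 1) = length (sol i a (Suc b))"
      using filledD[OF f, of "Suc a" b] filledD[OF f, of "Suc a" "Suc b"]
        filledD[OF f, of a "Suc b"] \<open>a < i\<close> \<open>b < n\<close>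
      by (simp_all add: algebra_simps)
    have len: "length (sol i (Suc a) (Suc b)) + 1 < 2 ^ w"
      using length_sol_le[where i = i and a = "Suc a" and b = "Suc b"] by (intro small_word) simp
    have "filled i a b (s\<lparr>regs := R, memory := (memory s)[a * N + b := length (sol i a b)]\<rparr>)" for R
      using filled_store[OF f le(2,1,3)] r by simp
    then have fin: "filled i a b (s\<lparr>regs := R, memory := (memory s)[a * N + b := v]\<rparr>)"
      if "v = length (sol i a b)" for R v
      using that by simp
    note step = sol_step[OF \<open>a < i\<close> le(1) \<open>b < n\<close>]
    have bounds: "a < length T" "b < length T"
      using \<open>a < i\<close> \<open>b < n\<close> le by (auto simp: n_def)
    show ?thesis
    proof (cases "T ! a = T ! b")
      case eq: True
      have v: "length (sol i (Suc a) (Suc b)) + 1 = length (sol i a b)"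
        unfolding step using eq by simp
      show ?thesis
        unfolding cell_prog_def same_but_def
        using True r le addr aN word addr' word' mem len bounds eq fin[OF v]
        by (simp del: One_nat_def Suc_eq_plus1 add_Suc_right add: add.assoc)
    next
      case neq: False
      have v: "(if length (sol i (Suc a) b) < length (sol i a (Suc b))
          then length (sol i a (Suc b)) else length (sol i (Suc a) b)) = length (sol i a b)"
        unfolding step using neq by simp
      show ?thesis
        unfolding cell_prog_def same_but_def
        using True r le addr aN word addr' word' mem bounds neq fin v
        by (cases "length (sol i (Suc a) b) < length (sol i a (Suc b))")
          (simp_all del: One_nat_def Suc_eq_plus1 add_Suc_right)
    qed
  qed
qed

lemma ready_same_but: "ready s \<Longrightarrow> same_but X s s' \<Longrightarrow> X \<inter> {0, 2, 3, 4} = {} \<Longrightarrow> ready s'"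
  unfolding ready_def same_but_def by auto

lemma wp_row:
  assumes s: "ready s" "regs s 5 = i" "regs s 6 = a"
    and le: "i \<le> n" "a \<le> i" and f: "filled i a N s"
  shows "wp w T row_prog (\<lambda>s' e'. same_but {7..11} s s' \<and> emitted s' = emitted s \<and>
    filled i a 0 s' \<and> e' \<le> e + 2 + 18 * N) s e"
proof -
  let ?I = "\<lambda>s' e'. same_but {7..11} s s' \<and> emitted s' = emitted s \<and> regs s' 7 \<le> N \<and>
    filled i a (regs s' 7) s' \<and> e' + 18 * regs s' 7 \<le> e + 1 + 18 * N"
  have r: "regs s 4 = N" "regs s 3 = 0"
    using s(1) by (auto simp: ready_def)
  show ?thesis
    unfolding row_prog_def wp_Seq wp_Move
  proof (rule wp_While_less[where I = ?I and m = "\<lambda>s. regs s 7"])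
    show "?I (s\<lparr>regs := (regs s)(7 := regs s 4)\<rparr>) (Suc e)"
      using f r by (simp add: same_but_def filled_def)
  next
    fix s1 e1
    assume I: "?I s1 e1" and "regs s1 3 < regs s1 7"
    then obtain b where b: "regs s1 7 = Suc b"
      by (cases "regs s1 7") auto
    have ready: "ready s1"
      using ready_same_but[OF s(1)] I by fastforce
    have r1: "regs s1 5 = i" "regs s1 6 = a" "regs s1 2 = 1"
      using I s ready by (auto simp: same_but_def ready_def)
    have bn: "b \<le> n" "Suc b < 2 ^ w"
      using I b by (auto simp: N_def intro: small_word)
    define s2 where "s2 = s1\<lparr>regs := (regs s1)(7 := b)\<rparr>"
    have "wp w T cell_prog (\<lambda>s' e'. same_but {8..11} s2 s' \<and> emitted s' = emitted s2 \<and>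
        filled i a b s' \<and> e' \<le> Suc (Suc e1) + 16) s2 (Suc (Suc e1))"
      by (rule wp_cell)
        (use ready r1 le bn I b in \<open>auto simp: s2_def ready_def filled_def\<close>)
    then have "wp w T cell_prog (\<lambda>s' e'. ?I s' e' \<and> regs s' 7 < regs s1 7) s2 (Suc (Suc e1))"
      by (rule wp_mono) (use I b in \<open>auto simp: s2_def same_but_def\<close>)
    then show "wp w T (Seq (Arith Sub 7 7 2) cell_prog)
        (\<lambda>s' e'. ?I s' e' \<and> regs s' 7 < regs s1 7) s1 (Suc e1)"
      using b bn r1 by (simp add: s2_def)
  next
    fix s1 e1
    assume I: "?I s1 e1" and "\<not> regs s1 3 < regs s1 7"
    then have "regs s1 7 = 0"
      using r by (simp add: same_but_def)
    with I show "same_but {7..11} s s1 \<and> emitted s1 = emitted s \<and>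
        filled i a 0 s1 \<and> Suc e1 \<le> e + 2 + 18 * N"
      by simp
  qed
qed

lemma wp_fill:
  assumes s: "ready s" "regs s 5 = i" and le: "i \<le> n"
  shows "wp w T fill_prog (\<lambda>s' e'. same_but {6..11} s s' \<and> emitted s' = emitted s \<and>
    filled i 0 0 s' \<and> e' \<le> e + 2 + (18 * N + 4) * N) s e"
proof -
  let ?K = "18 * N + 4"
  let ?I = "\<lambda>s' e'. same_but {6..11} s s' \<and> emitted s' = emitted s \<and> regs s' 6 \<le> Suc i \<and>
    filled i (regs s' 6) 0 s' \<and> e' + ?K * regs s' 6 \<le> e + 1 + ?K * Suc i"
  have r: "regs s 2 = 1" "regs s 3 = 0"
    using s(1) by (auto simp: ready_def)
  have i: "Suc i < 2 ^ w"
    using le by (intro small_word) simp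
  show ?thesis
    unfolding fill_prog_def wp_Seq wp_Arith
  proof (rule wp_While_less[where I = ?I and m = "\<lambda>s. regs s 6"])
    show "?I (s\<lparr>regs := (regs s)(6 := arith_val w Add (regs s 5) (regs s 2))\<rparr>) (Suc e)"
      using r s(2) i by (simp add: same_but_def filled_def)
  next
    fix s1 e1
    assume I: "?I s1 e1" and "regs s1 3 < regs s1 6"
    then obtain a where a: "regs s1 6 = Suc a"
      by (cases "regs s1 6") auto
    have ready: "ready s1"
      using ready_same_but[OF s(1)] I by fastforce
    have r1: "regs s1 5 = i" "regs s1 2 = 1"
      using I s ready by (auto simp: same_but_def ready_def)
    have ai: "a \<le> i" "Suc a < 2 ^ w"
      using I a i by auto
    define s2 where "s2 = s1\<lparr>regs := (regs s1)(6 := a)\<rparr>"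
    have "filled i a N s2"
      unfolding filled_def
    proof (intro allI impI)
      fix a' b' assume "a' \<le> i" "b' \<le> n" "a < a' \<or> a = a' \<and> N \<le> b'"
      moreover from this have "Suc a < a' \<or> Suc a = a' \<and> 0 \<le> b'"
        by (auto simp: N_def)
      ultimately show "memory s2 ! (a' * N + b') = length (sol i a' b')"
        using I a unfolding s2_def by (auto intro!: filledD)
    qed
    then have "wp w T row_prog (\<lambda>s' e'. same_but {7..11} s2 s' \<and> emitted s' = emitted s2 \<and>
        filled i a 0 s' \<and> e' \<le> Suc (Suc e1) + 2 + 18 * N) s2 (Suc (Suc e1))"
      by (intro wp_row) (use ready r1 le ai in \<open>auto simp: s2_def ready_def\<close>)
    then have "wp w T row_prog (\<lambda>s' e'. ?I s' e' \<and> regs s' 6 < regs s1 6) s2 (Suc (Suc e1))"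
      by (rule wp_mono) (use I a in \<open>auto simp: s2_def same_but_def\<close>)
    then show "wp w T (Seq (Arith Sub 6 6 2) row_prog)
        (\<lambda>s' e'. ?I s' e' \<and> regs s' 6 < regs s1 6) s1 (Suc e1)"
      using a ai r1 by (simp add: s2_def)
  next
    fix s1 e1
    assume I: "?I s1 e1" and "\<not> regs s1 3 < regs s1 6"
    then have "regs s1 6 = 0"
      using r by (simp add: same_but_def)
    moreover have "?K * Suc i \<le> ?K * N"
      using le by (intro mult_le_mono) (simp_all add: N_def)
    ultimately show "same_but {6..11} s s1 \<and> emitted s1 = emitted s \<and>
        filled i 0 0 s1 \<and> Suc e1 \<le> e + 2 + ?K * N"
      using I by auto
  qed
qed

definition feasible :: "nat \<Rightarrow> nat \<Rightarrow> bool" where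
  "feasible i j \<longleftrightarrow> i < j \<and> j < n \<and> sol i 0 j \<noteq> []"

definition gain :: "nat \<Rightarrow> nat \<Rightarrow> nat" where
  "gain i j = 2 * length (sol i 0 j) + j - i"

definition best_among :: "(nat \<Rightarrow> nat \<Rightarrow> bool) \<Rightarrow> 'a state \<Rightarrow> bool" where
  "best_among P s \<longleftrightarrow>
     (regs s 13 = 0 \<or> feasible (regs s 14) (regs s 15) \<and> regs s 13 = gain (regs s 14) (regs s 15)) \<and>
     (\<forall>i j. P i j \<longrightarrow> feasible i j \<longrightarrow> gain i j \<le> regs s 13)"

lemma wp_scan:
  assumes s: "ready s" "regs s 5 = i" and le: "i \<le> n" and f: "filled i 0 0 s"
    and best: "best_among (\<lambda>i' j'. i < i') s"
  shows "wp w T scan_prog (\<lambda>s' e'. same_but {8, 12, 13, 14, 15} s s' \<and> emitted s' = emitted s \<and>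
    best_among (\<lambda>i' j'. i \<le> i') s' \<and> e' \<le> e + 2 + 16 * n) s e"
proof -
  let ?P = "\<lambda>j i' j'. i < i' \<or> i' = i \<and> j \<le> j'"
  let ?I = "\<lambda>s' e'. same_but {8, 12, 13, 14, 15} s s' \<and> emitted s' = emitted s \<and>
    memory s' = memory s \<and> regs s' 12 \<le> n \<and> best_among (?P (regs s' 12)) s' \<and>
    e' + 16 * regs s' 12 \<le> e + 1 + 16 * n"
  have r: "regs s 0 = n" "regs s 2 = 1" "regs s 3 = 0" "length (memory s) = (n + 2)\<^sup>2"
    using s(1) by (auto simp: ready_def)
  show ?thesis
    unfolding scan_prog_def wp_Seq wp_Move
  proof (rule wp_While_less[where I = ?I and m = "\<lambda>s. regs s 12"])
    show "?I (s\<lparr>regs := (regs s)(12 := regs s 0)\<rparr>) (Suc e)"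
      using r best by (auto simp: same_but_def best_among_def feasible_def)
  next
    fix s1 e1
    assume I: "?I s1 e1" and "regs s1 3 < regs s1 12"
    then obtain j where j: "regs s1 12 = Suc j"
      by (cases "regs s1 12") auto
    have r1: "regs s1 5 = i" "regs s1 2 = 1" "regs s1 3 = 0" "memory s1 = memory s"
      using I s r by (auto simp: same_but_def)
    have jn: "j < n" "Suc j < 2 ^ w" "j < (n + 2)\<^sup>2"
      using I j small_word[of "Suc j"] addr_bound[of 0 j] by (auto simp: N_def)
    define L where "L = length (sol i 0 j)"
    have mem: "memory s ! j = L"
      using filledD[OF f, of 0 j] jn by (simp add: L_def)
    have len: "L + L < 2 ^ w" "L + L + j < 2 ^ w"
      using length_sol_le[where i = i and a = 0 and b = j] jn
      unfolding L_def by (auto intro!: small_word)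
    have best1: "best_among (?P (Suc j)) s1"
      using I j by simp
    let ?keep = "\<lambda>s'. regs s' 13 = regs s1 13 \<and> regs s' 14 = regs s1 14 \<and> regs s' 15 = regs s1 15"
    have P: "?P j i' j' \<longleftrightarrow> ?P (Suc j) i' j' \<or> i' = i \<and> j' = j" for i' j'
      by (cases "j' = j") auto
    have keep: "best_among (?P j) s'"
      if "?keep s'" "feasible i j \<longrightarrow> gain i j \<le> regs s1 13" for s'
      using best1 that unfolding best_among_def P by auto
    have change: "best_among (?P j) s'"
      if "regs s' 13 = gain i j" "regs s' 14 = i" "regs s' 15 = j" "feasible i j"
        "regs s1 13 < gain i j" for s'
    proof -
      have "gain i' j' \<le> gain i j" if "?P j i' j'" "feasible i' j'" for i' j'
        using that(1) unfolding P
      proof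
        assume "?P (Suc j) i' j'"
        with best1 that(2) have "gain i' j' \<le> regs s1 13"
          unfolding best_among_def by blast
        with \<open>regs s1 13 < gain i j\<close> show ?thesis by simp
      qed simp
      with that show ?thesis by (simp add: best_among_def)
    qed
    consider (skip) "\<not> i < j" | (empty) "i < j" "sol i 0 j = []" | (feas) "feasible i j"
      using jn by (auto simp: feasible_def)
    then show "wp w T (Seq (Arith Sub 12 12 2)
     (Cond (WordLess 5 12)
       (Seq (Load 8 12)
         (Cond (WordLess 3 8)
           (block [Arith Add 8 8 8, Arith Add 8 8 12, Arith Sub 8 8 5,
              Cond (WordLess 13 8) (block [Move 13 8, Move 14 5, Move 15 12]) Skip])
           Skip))
       Skip)) (\<lambda>s' e'. ?I s' e' \<and> regs s' 12 < regs s1 12) s1 (Suc e1)"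
    proof cases
      case skip
      with I j r1 jn r show ?thesis
        by (simp add: same_but_def keep feasible_def)
    next
      case empty
      with I j r1 jn r mem show ?thesis
        by (simp add: same_but_def keep feasible_def L_def)
    next
      case feas
      then have "i < j" "0 < L"
        by (auto simp: feasible_def L_def)
      have vals: "arith_val w Sub (Suc j) (Suc 0) = j" "arith_val w Add L L = L + L"
          "arith_val w Add (L + L) j = L + L + j" "arith_val w Sub (L + L + j) i = gain i j"
        using len jn \<open>i < j\<close> by (auto simp: gain_def L_def)
      show ?thesis
        using I j r1 jn r mem feas \<open>i < j\<close> \<open>0 < L\<close>
        by (cases "regs s1 13 < gain i j") (simp_all add: same_but_def keep change vals)
    qed
  next
    fix s1 e1
    assume I: "?I s1 e1" and "\<not> regs s1 3 < regs s1 12"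
    then have "regs s1 12 = 0"
      using r by (simp add: same_but_def)
    then show "same_but {8, 12, 13, 14, 15} s s1 \<and> emitted s1 = emitted s \<and>
        best_among (\<lambda>i' j'. i \<le> i') s1 \<and> Suc e1 \<le> e + 2 + 16 * n"
      using I by (auto simp: best_among_def le_less)
  qed
qed

lemma wp_search:
  assumes s: "ready s" "regs s 13 = 0"
  shows "wp w T search_prog (\<lambda>s' e'. ready s' \<and> emitted s' = emitted s \<and>
    best_among (\<lambda>i' j'. True) s' \<and> e' \<le> e + 2 + ((18 * N + 4) * N + 16 * n + 6) * n) s e"
proof -
  let ?K = "(18 * N + 4) * N + 16 * n + 6"
  let ?I = "\<lambda>s' e'. ready s' \<and> emitted s' = emitted s \<and> regs s' 5 \<le> n \<and>
    best_among (\<lambda>i' j'. regs s' 5 \<le> i') s' \<and> e' + ?K * regs s' 5 \<le> e + 1 + ?K * n"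
  have r: "regs s 0 = n"
    using s(1) by (auto simp: ready_def)
  show ?thesis
    unfolding search_prog_def wp_Seq wp_Move
  proof (rule wp_While_less[where I = ?I and m = "\<lambda>s. regs s 5"])
    show "?I (s\<lparr>regs := (regs s)(5 := regs s 0)\<rparr>) (Suc e)"
      using r s by (auto simp: best_among_def feasible_def ready_def)
  next
    fix s1 e1
    assume I: "?I s1 e1" and "regs s1 3 < regs s1 5"
    then obtain i where i: "regs s1 5 = Suc i"
      by (cases "regs s1 5") auto
    have r1: "regs s1 2 = 1"
      using I by (auto simp: ready_def)
    have "i \<le> n" "Suc i < 2 ^ w"
      using I i small_word[of "Suc i"] by auto
    define s2 where "s2 = s1\<lparr>regs := (regs s1)(5 := i)\<rparr>"
    have s2: "ready s2" "regs s2 5 = i"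
      using I by (auto simp: s2_def ready_def)
    have "wp w T scan_prog (\<lambda>s' e'. ?I s' e' \<and> regs s' 5 < regs s1 5) s3 e3"
      if s3: "same_but {6..11} s2 s3" "emitted s3 = emitted s2" "filled i 0 0 s3"
        "e3 \<le> Suc (Suc e1) + 2 + (18 * N + 4) * N" for s3 e3
    proof -
      have ready: "ready s3"
        using ready_same_but[OF s2(1) s3(1)] by simp
      have r3: "regs s3 5 = i" "\<forall>r\<in>{13, 14, 15}. regs s3 r = regs s1 r"
        using s3(1) by (auto simp: same_but_def s2_def)
      have "best_among (\<lambda>i' j'. i < i') s3"
        using I r3 i by (simp add: best_among_def Suc_le_eq)
      then show ?thesis
        using ready r3(1) s3 \<open>i \<le> n\<close>
      proof (intro wp_mono[OF wp_scan])
        fix s' e'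
        assume *: "same_but {8, 12, 13, 14, 15} s3 s' \<and> emitted s' = emitted s3 \<and>
          best_among (\<lambda>i' j'. i \<le> i') s' \<and> e' \<le> e3 + 2 + 16 * n"
        then have "ready s'" "regs s' 5 = i"
          using ready_same_but[OF ready conjunct1[OF *]] r3(1) by (auto simp: same_but_def)
        with * I i s3 \<open>i \<le> n\<close> show "?I s' e' \<and> regs s' 5 < regs s1 5"
          by (auto simp: s2_def)
      qed auto
    qed
    then have "wp w T fill_prog (wp w T scan_prog (\<lambda>s' e'. ?I s' e' \<and> regs s' 5 < regs s1 5))
        s2 (Suc (Suc e1))"
      by (intro wp_mono[OF wp_fill[OF s2 \<open>i \<le> n\<close>]]) blast
    then show "wp w T (Seq (Arith Sub 5 5 2) (Seq fill_prog scan_prog))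
        (\<lambda>s' e'. ?I s' e' \<and> regs s' 5 < regs s1 5) s1 (Suc e1)"
      using i \<open>Suc i < 2 ^ w\<close> r1 by (simp add: s2_def)
  next
    fix s1 e1
    assume I: "?I s1 e1" and "\<not> regs s1 3 < regs s1 5"
    then have "regs s1 5 = 0"
      by (simp add: ready_def)
    with I show "ready s1 \<and> emitted s1 = emitted s \<and> best_among (\<lambda>i' j'. True) s1 \<and>
        Suc e1 \<le> e + 2 + ?K * n"
      by simp
  qed
qed

lemma wp_trace:
  assumes s: "ready s" "regs s 15 = j" and le: "i \<le> n" "j \<le> n" and f: "filled i 0 0 s"
  shows "wp w T trace_prog (\<lambda>s' e'. same_but {6..10} s s' \<and> memory s' = memory s \<and>
    emitted s' = emitted s @ sol i 0 j \<and> e' \<le> e + 5 + 32 * n) s e"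
proof -
  let ?I = "\<lambda>s' e'. same_but {6..10} s s' \<and> memory s' = memory s \<and>
    regs s' 6 \<le> i \<and> regs s' 7 \<le> n \<and> regs s' 8 = length (sol i (regs s' 6) (regs s' 7)) \<and>
    emitted s' @ sol i (regs s' 6) (regs s' 7) = emitted s @ sol i 0 j \<and>
    e' \<le> e + 3 + 16 * (regs s' 6 + regs s' 7)"
  have r: "regs s 2 = 1" "regs s 3 = 0" "regs s 4 = N" "length (memory s) = (n + 2)\<^sup>2"
    using s(1) by (auto simp: ready_def)
  let ?body = "block
       [Arith Mul 9 6 4, Arith Add 9 9 7,
        Cond (SymEq 6 7)
          (block [Emit 6, Arith Add 6 6 2, Arith Add 7 7 2])
          (block [Arith Add 10 9 4, Load 10 10,
             Cond (WordEq 10 8) (Arith Add 6 6 2) (Arith Add 7 7 2)]),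
        Arith Mul 9 6 4, Arith Add 9 9 7, Load 8 9]"
  have loop: "wp w T (While (WordLess 3 8) ?body) (\<lambda>s' e'. same_but {6..10} s s' \<and>
      memory s' = memory s \<and> emitted s' = emitted s @ sol i 0 j \<and> e' \<le> e + 4 + 32 * n) s0 e0"
    if "?I s0 e0" for s0 e0
    using that
  proof (rule wp_While_less[where I = ?I and m = "\<lambda>s. 2 * n - (regs s 6 + regs s 7)"])
    fix s1 e1
    assume I: "?I s1 e1" and pos: "regs s1 3 < regs s1 8"
    define a b where "a = regs s1 6" and "b = regs s1 7"
    have r1: "regs s1 2 = 1" "regs s1 3 = 0" "regs s1 4 = N" "memory s1 = memory s"
      using I r by (auto simp: same_but_def)
    have "sol i a b \<noteq> []"
      using I pos by (auto simp: a_def b_def)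
    then have ab: "a < i" "b < n"
      using sol_stop[of i a b] by (auto simp: not_le[symmetric])
    have bounds: "a < length T" "b < length T" "Suc a < 2 ^ w" "Suc b < 2 ^ w"
      using ab le by (auto simp: n_def intro!: small_word)
    have addr: "a' * N + b' < (n + 2)\<^sup>2" "a' * N < 2 ^ w" "a' * N + b' < 2 ^ w"
      if "a' \<le> i" "b' \<le> n" for a' b'
    proof -
      show *: "a' * N + b' < (n + 2)\<^sup>2"
        using addr_bound[of a' b'] that le by (simp add: N_def)
      show "a' * N < 2 ^ w" "a' * N + b' < 2 ^ w"
        using * words by linarith+
    qed
    have below: "a * N + b + N = Suc a * N + b"
      by simp
    have mem: "memory s ! (a' * N + b') = length (sol i a' b')" if "a' \<le> i" "b' \<le> n" for a' b'
      using filledD[OF f that] by auto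
    note step = sol_step[OF \<open>a < i\<close> le(1) \<open>b < n\<close>]
    note facts = I[folded a_def b_def] r r1 bounds ab le a_def[symmetric] b_def[symmetric]
      addr[of a b] mem[of a b]
    show "wp w T ?body (\<lambda>s' e'. ?I s' e' \<and>
        2 * n - (regs s' 6 + regs s' 7) < 2 * n - (regs s1 6 + regs s1 7)) s1 (Suc e1)"
    proof (cases "T ! a = T ! b")
      case True
      then have "sol i a b = T ! a # sol i (Suc a) (Suc b)"
        unfolding step by simp
      with True facts addr[of "Suc a" "Suc b"] mem[of "Suc a" "Suc b"] show ?thesis
        by (simp add: same_but_def del: mult_Suc)
    next
      case neq: False
      show ?thesis
      proof (cases "length (sol i (Suc a) b) = length (sol i a b)")
        case True
        then have "sol i a b = sol i (Suc a) b"
          unfolding step using neq by (auto split: if_splits)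
        with True neq facts addr[of "Suc a" b] mem[of "Suc a" b] show ?thesis
          by (simp add: same_but_def below del: mult_Suc)
      next
        case False
        then have "sol i a b = sol i a (Suc b)"
          unfolding step using neq by (auto split: if_splits)
        with False neq facts addr[of "Suc a" b] mem[of "Suc a" b]
          addr[of a "Suc b"] mem[of a "Suc b"] show ?thesis
          by (simp add: same_but_def below del: mult_Suc)
      qed
    qed
  next
    fix s1 e1
    assume I: "?I s1 e1" and "\<not> regs s1 3 < regs s1 8"
    then have "sol i (regs s1 6) (regs s1 7) = []"
      using r by (simp add: same_but_def)
    with I le show "same_but {6..10} s s1 \<and> memory s1 = memory s \<and>
        emitted s1 = emitted s @ sol i 0 j \<and> Suc e1 \<le> e + 4 + 32 * n"
      by auto
  qed
  have "j < (n + 2)\<^sup>2"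
    using addr_bound[of 0 j] le by (simp add: N_def)
  moreover have "memory s ! j = length (sol i 0 j)"
    using filledD[OF f, of 0 j] le by simp
  ultimately show ?thesis
    unfolding trace_prog_def wp_Seq wp_Move wp_Load
    by (intro conjI wp_mono[OF loop]) (use s(2) r le in \<open>auto simp: same_but_def\<close>)
qed

lemma wp_middle:
  assumes s: "ready s" "regs s 14 = i" "regs s 15 = j" and le: "i \<le> j" "j \<le> n"
  shows "wp w T middle_prog (\<lambda>s' e'. same_but {6} s s' \<and> memory s' = memory s \<and>
    emitted s' = emitted s @ drop i (take j T) \<and> e' \<le> e + 2 + 3 * n) s e"
proof -
  let ?I = "\<lambda>s' e'. same_but {6} s s' \<and> memory s' = memory s \<and> i \<le> regs s' 6 \<and> regs s' 6 \<le> j \<and>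
    emitted s' = emitted s @ drop i (take (regs s' 6) T) \<and> e' \<le> e + 1 + 3 * regs s' 6"
  have r: "regs s 2 = 1"
    using s(1) by (auto simp: ready_def)
  show ?thesis
    unfolding middle_prog_def wp_Seq wp_Move
  proof (rule wp_While_less[where I = ?I and m = "\<lambda>s. n - regs s 6"])
    show "?I (s\<lparr>regs := (regs s)(6 := regs s 14)\<rparr>) (Suc e)"
      using s le by (simp add: same_but_def)
  next
    fix s1 e1
    assume I: "?I s1 e1" and less: "regs s1 6 < regs s1 15"
    have r1: "regs s1 15 = j" "regs s1 2 = 1"
      using I s r by (auto simp: same_but_def)
    with less le have "regs s1 6 < length T" "Suc (regs s1 6) < 2 ^ w"
      by (auto simp: n_def intro!: small_word)
    then show "wp w T (Seq (Emit 6) (Arith Add 6 6 2))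
        (\<lambda>s' e'. ?I s' e' \<and> n - regs s' 6 < n - regs s1 6) s1 (Suc e1)"
      using I less r1 le by (simp add: same_but_def take_Suc_conv_app_nth n_def)
  next
    fix s1 e1
    assume I: "?I s1 e1" and "\<not> regs s1 6 < regs s1 15"
    then have "regs s1 6 = j"
      using s by (simp add: same_but_def)
    with I le show "same_but {6} s s1 \<and> memory s1 = memory s \<and>
        emitted s1 = emitted s @ drop i (take j T) \<and> Suc e1 \<le> e + 2 + 3 * n"
      by auto
  qed
qed

definition answer :: "nat \<Rightarrow> nat \<Rightarrow> 'a list" where
  "answer i j = sol i 0 j @ drop i (take j T) @ sol i 0 j"

lemma wp_output:
  assumes s: "ready s" "regs s 5 = i" "regs s 14 = i" "regs s 15 = j" and le: "i \<le> j" "j \<le> n"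
  shows "wp w T (block [fill_prog, trace_prog, middle_prog, trace_prog])
    (\<lambda>s' e'. emitted s' = emitted s @ answer i j \<and>
      e' \<le> e + 15 + (18 * N + 4) * N + 67 * n) s e"
  unfolding block.simps wp_Seq wp_Skip
proof (rule wp_mono[OF wp_fill[OF s(1,2)]])
  show "i \<le> n"
    using le by simp
  fix s1 e1
  assume s1: "same_but {6..11} s s1 \<and> emitted s1 = emitted s \<and> filled i 0 0 s1 \<and>
    e1 \<le> e + 2 + (18 * N + 4) * N"
  then have ready1: "ready s1" and r1: "regs s1 14 = i" "regs s1 15 = j"
    using ready_same_but[OF s(1) conjunct1[OF s1]] s by (auto simp: same_but_def)
  show "wp w T trace_prog (wp w T middle_prog (wp w T trace_prog (\<lambda>s' e'.
      emitted s' = emitted s @ answer i j \<and> Suc e' \<le> e + 15 + (18 * N + 4) * N + 67 * n))) s1 e1"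
  proof (rule wp_mono[OF wp_trace[OF ready1 r1(2) \<open>i \<le> n\<close> le(2)]])
    show "filled i 0 0 s1" using s1 by blast
    fix s2 e2
    assume s2: "same_but {6..10} s1 s2 \<and> memory s2 = memory s1 \<and>
      emitted s2 = emitted s1 @ sol i 0 j \<and> e2 \<le> e1 + 5 + 32 * n"
    then have ready2: "ready s2" and r2: "regs s2 14 = i" "regs s2 15 = j"
      using ready_same_but[OF ready1 conjunct1[OF s2]] r1 by (auto simp: same_but_def)
    show "wp w T middle_prog (wp w T trace_prog (\<lambda>s' e'.
      emitted s' = emitted s @ answer i j \<and> Suc e' \<le> e + 15 + (18 * N + 4) * N + 67 * n)) s2 e2"
    proof (rule wp_mono[OF wp_middle[OF ready2 r2 le]])
      fix s3 e3
      assume s3: "same_but {6} s2 s3 \<and> memory s3 = memory s2 \<and>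
        emitted s3 = emitted s2 @ drop i (take j T) \<and> e3 \<le> e2 + 2 + 3 * n"
      then have ready3: "ready s3" and r3: "regs s3 15 = j"
        using ready_same_but[OF ready2 conjunct1[OF s3]] r2 by (auto simp: same_but_def)
      have "filled i 0 0 s3"
        using s1 s2 s3 by (simp add: filled_def)
      with s1 s2 s3 show "wp w T trace_prog (\<lambda>s' e'. emitted s' = emitted s @ answer i j \<and>
          Suc e' \<le> e + 15 + (18 * N + 4) * N + 67 * n) s3 e3"
        by (intro wp_mono[OF wp_trace[OF ready3 r3 \<open>i \<le> n\<close> le(2)]]) (auto simp: answer_def)
    qed
  qed
qed

lemma wp_main:
  "wp w T main_prog (\<lambda>s' e'.
     (if \<exists>i j. feasible i j
      then \<exists>i j. feasible i j \<and> (\<forall>i' j'. feasible i' j' \<longrightarrow> gain i' j' \<le> gain i j) \<and>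
        emitted s' = answer i j
      else emitted s' = []) \<and> e' \<le> 200 * N ^ 3)
   (initial_state n ((n + 2)\<^sup>2)) 0"
proof -
  define s0 :: "'a state" where
    "s0 = (initial_state n ((n + 2)\<^sup>2))\<lparr>regs := (\<lambda>_. 0)(0 := n, 2 := 1, 4 := N)\<rparr>"
  have ready: "ready s0" "regs s0 13 = 0" and empty: "emitted s0 = []"
    by (simp_all add: s0_def initial_state_def ready_def)
  have words: "1 < (2::nat) ^ w" "n + 1 < 2 ^ w"
    by (auto intro: small_word)
  have "0 < w"
    using words(1) by (cases w) auto
  let ?K = "(18 * N + 4) * N + 16 * n + 6"
  have time: "?K * n + ((18 * N + 4) * N + 67 * n) + 24 \<le> 200 * N ^ 3"
    by (simp add: N_def power3_eq_cube algebra_simps)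
  let ?Q = "\<lambda>s' e'. (if \<exists>i j. feasible i j
      then \<exists>i j. feasible i j \<and> (\<forall>i' j'. feasible i' j' \<longrightarrow> gain i' j' \<le> gain i j) \<and>
        emitted s' = answer i j
      else emitted s' = []) \<and> e' \<le> 200 * N ^ 3"
  define R where "R = wp w T (Cond (WordLess 3 13)
    (block [Move 5 14, fill_prog, trace_prog, middle_prog, trace_prog]) Skip) ?Q"
  have "wp w T search_prog R s0 (Suc (Suc 0))"
    unfolding R_def
  proof (rule wp_mono[OF wp_search[OF ready]])
    fix s e
    assume s: "ready s \<and> emitted s = emitted s0 \<and> best_among (\<lambda>i' j'. True) s \<and>
      e \<le> Suc (Suc 0) + 2 + ?K * n"
    define i j where "i = regs s 14" and "j = regs s 15"
    have best: "regs s 13 = 0 \<or> feasible i j \<and> regs s 13 = gain i j"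
        "feasible i' j' \<Longrightarrow> gain i' j' \<le> regs s 13" for i' j'
      using s unfolding best_among_def i_def j_def by blast+
    have "regs s 3 = 0"
      using s by (simp add: ready_def)
    show "wp w T (Cond (WordLess 3 13)
       (block [Move 5 14, fill_prog, trace_prog, middle_prog, trace_prog]) Skip) ?Q s e"
    proof (cases "regs s 13 = 0")
      case True
      have "\<not> feasible i' j'" for i' j'
        using best(2)[of i' j'] True by (auto simp: gain_def feasible_def)
      with True s \<open>regs s 3 = 0\<close> time empty show ?thesis
        by (simp add: add.assoc)
    next
      case False
      define s' where "s' = s\<lparr>regs := (regs s)(5 := i)\<rparr>"
      have feas: "feasible i j" and opt: "\<forall>i' j'. feasible i' j' \<longrightarrow> gain i' j' \<le> gain i j"
        using best False by auto
      have "wp w T (block [fill_prog, trace_prog, middle_prog, trace_prog]) ?Q s' (Suc (Suc e))"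
      proof (rule wp_mono[OF wp_output])
        show "ready s'" "regs s' 5 = i" "regs s' 14 = i" "regs s' 15 = j" "i \<le> j" "j \<le> n"
          using s feas by (simp_all add: s'_def ready_def i_def j_def feasible_def)
        fix s'' e'
        assume "emitted s'' = emitted s' @ answer i j \<and>
          e' \<le> Suc (Suc e) + 15 + (18 * N + 4) * N + 67 * n"
        with s empty feas opt time show "?Q s'' e'"
          by (auto simp: s'_def)
      qed
      with False \<open>regs s 3 = 0\<close> show ?thesis
        by (simp add: s'_def i_def)
    qed
  qed
  then show ?thesis
    unfolding main_prog_def wp_Seq wp_Const wp_Arith R_def[symmetric]
    using words \<open>0 < w\<close> by (simp add: s0_def initial_state_def N_def)
qed

lemma answer_subseq:
  assumes "i \<le> j" "j \<le> n"
  shows "subseq (answer i j) T"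
proof -
  have "T = take i T @ drop i (take j T) @ drop j T"
    using assms by (metis append.assoc append_take_drop_id min.absorb1 take_take)
  moreover have "subseq (answer i j) (take i T @ drop i (take j T) @ drop j T)"
    unfolding answer_def
    by (intro list_emb_append_mono subseq_lcs2)
      (use subseq_lcs1[of "drop 0 (take i T)" "drop j T"] in auto)
  ultimately show ?thesis by simp
qed

lemma length_answer: "feasible i j \<Longrightarrow> length (answer i j) = gain i j"
  unfolding answer_def gain_def feasible_def by (auto simp: n_def)

lemma answer_noninteger: "feasible i j \<Longrightarrow> has_exponent_in (answer i j) (Rat_ge1 - Nat_pos)"
  unfolding noninteger_exponent_iff answer_def feasible_def
  by (rule exI[of _ "sol i 0 j"], rule exI[of _ "drop i (take j T)"]) (auto simp: n_def)

lemma feasible_if_subseq: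
  assumes "subseq S T" "has_exponent_in S (Rat_ge1 - Nat_pos)"
  obtains i j where "feasible i j" "length S \<le> gain i j"
proof -
  obtain W V where S: "S = W @ V @ W" "W \<noteq> []" "V \<noteq> []"
    using assms(2) unfolding noninteger_exponent_iff by blast
  from assms(1) obtain A B C where T: "T = A @ B @ C"
    and sub: "subseq W A" "subseq V B" "subseq W C"
    unfolding S(1) by (metis list_emb_appendD)
  define i j where "i = length A" and "j = length A + length B"
  have ij: "take i T = A" "drop j T = C"
    by (simp_all add: T i_def j_def)
  have "length W \<le> length (sol i 0 j)"
    using length_lcs_maximal[OF sub(1,3)] ij by simp
  moreover have "length V \<le> length B" "length W \<le> length C"
    using sub list_emb_length by blast+
  moreover have "0 < length W" "0 < length V"
    using S by simp_all
  ultimately have "feasible i j" "length S \<le> gain i j"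
    unfolding feasible_def gain_def length_greater_0_conv[symmetric]
    by (auto simp: i_def j_def n_def T S(1) simp del: length_greater_0_conv)
  then show thesis by (rule that)
qed

lemma longest_answer:
  assumes "feasible i j" "\<And>i' j'. feasible i' j' \<Longrightarrow> gain i' j' \<le> gain i j"
  shows "longest_subseq_with_exponent_in (Rat_ge1 - Nat_pos) T (answer i j)"
  unfolding longest_subseq_with_exponent_in_def
proof (intro conjI allI impI)
  show "subseq (answer i j) T"
    using assms(1) by (intro answer_subseq) (auto simp: feasible_def)
  show "has_exponent_in (answer i j) (Rat_ge1 - Nat_pos)"
    using assms(1) by (rule answer_noninteger)
  fix S' assume "subseq S' T \<and> has_exponent_in S' (Rat_ge1 - Nat_pos)"
  then obtain i' j' where "feasible i' j'" "length S' \<le> gain i' j'"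
    using feasible_if_subseq by blast
  with assms length_answer show "length S' \<le> length (answer i j)"
    by (metis order.trans)
qed

lemma ex_noninteger_iff:
  "(\<exists>S. subseq S T \<and> has_exponent_in S (Rat_ge1 - Nat_pos)) \<longleftrightarrow> (\<exists>i j. feasible i j)"
proof
  assume "\<exists>i j. feasible i j"
  then obtain i j where "feasible i j" by blast
  then show "\<exists>S. subseq S T \<and> has_exponent_in S (Rat_ge1 - Nat_pos)"
    using answer_subseq[of i j] answer_noninteger[of i j] by (auto simp: feasible_def)
qed (use feasible_if_subseq in blast)

end

theorem theorem1:
  "\<exists>(c :: com) (time :: nat \<Rightarrow> nat) (space :: nat \<Rightarrow> nat).
     (\<lambda>n. real (time n)) \<in> O(\<lambda>n. real n ^ 3) \<and>
     (\<lambda>n. real (space n)) \<in> O(\<lambda>n. real n ^ 2) \<and>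
     solves_within c time space
       (\<lambda>(T :: 'a::linorder list) S.
          if \<exists>S'. subseq S' T \<and> has_exponent_in S' (Rat_ge1 - Nat_pos)
          then longest_subseq_with_exponent_in (Rat_ge1 - Nat_pos) T S
          else S = [])"
proof (intro exI conjI)
  show "(\<lambda>n. real (200 * Suc n ^ 3)) \<in> O(\<lambda>n. real n ^ 3)"
  proof (rule bigoI[where c = 1600], rule eventually_mono[OF eventually_ge_at_top[of 1]])
    fix n :: nat assume "1 \<le> n"
    then have "Suc n ^ 3 \<le> (2 * n) ^ 3"
      by (intro power_mono) simp_all
    then have "real (200 * Suc n ^ 3) \<le> real (1600 * n ^ 3)"
      unfolding of_nat_le_iff by (simp add: power_mult_distrib)
    then show "norm (real (200 * Suc n ^ 3)) \<le> 1600 * norm (real n ^ 3)"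
      by simp
  qed
  show "(\<lambda>n. real ((n + 2)\<^sup>2)) \<in> O(\<lambda>n. real n ^ 2)"
  proof (rule bigoI[where c = 9], rule eventually_mono[OF eventually_ge_at_top[of 1]])
    fix n :: nat assume "1 \<le> n"
    then have "(n + 2)\<^sup>2 \<le> (3 * n)\<^sup>2"
      by (intro power_mono) simp_all
    then have "real ((n + 2)\<^sup>2) \<le> real (9 * n\<^sup>2)"
      unfolding of_nat_le_iff by (simp add: power_mult_distrib)
    then show "norm (real ((n + 2)\<^sup>2)) \<le> 9 * norm (real n ^ 2)"
      by simp
  qed
  show "solves_within main_prog (\<lambda>n. 200 * Suc n ^ 3) (\<lambda>n. (n + 2)\<^sup>2)
       (\<lambda>(T :: 'a list) S.
          if \<exists>S'. subseq S' T \<and> has_exponent_in S' (Rat_ge1 - Nat_pos)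
          then longest_subseq_with_exponent_in (Rat_ge1 - Nat_pos) T S
          else S = [])"
    unfolding solves_within_def
  proof (intro allI impI)
    fix T :: "'a list" and w
    assume "length T < 2 ^ w \<and> (length T + 2)\<^sup>2 \<le> 2 ^ w"
    then interpret word_ram w T "length T" "Suc (length T)"
      by unfold_locales auto
    obtain t s where
      "exec w T main_prog (initial_state (length T) ((length T + 2)\<^sup>2)) t s"
      "t \<le> 200 * Suc (length T) ^ 3"
      and out: "if \<exists>i j. feasible i j
        then \<exists>i j. feasible i j \<and> (\<forall>i' j'. feasible i' j' \<longrightarrow> gain i' j' \<le> gain i j) \<and>
          emitted s = answer i j
        else emitted s = []"
      using wp_main unfolding wp_def by auto
    moreover have "if \<exists>S'. subseq S' T \<and> has_exponent_in S' (Rat_ge1 - Nat_pos)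
        then longest_subseq_with_exponent_in (Rat_ge1 - Nat_pos) T (emitted s)
        else emitted s = []"
      using out longest_answer unfolding ex_noninteger_iff by (auto split: if_splits)
    ultimately show "\<exists>t s. exec w T main_prog (initial_state (length T) ((length T + 2)\<^sup>2)) t s \<and>
        t \<le> 200 * Suc (length T) ^ 3 \<and>
        (if \<exists>S'. subseq S' T \<and> has_exponent_in S' (Rat_ge1 - Nat_pos)
         then longest_subseq_with_exponent_in (Rat_ge1 - Nat_pos) T (emitted s)
         else emitted s = [])"
      by blast
  qed
qed

end
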